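(* Let $a,b,c$ be commuting indeterminates and let $D$ be the derivation of $\mathbb{Q}[a,b,c]$ determined by $D(a)=ab^2$, $D(b)=b^2c$, $D(c)=bc^2$. For $n\ge1$ define integers $p(n,k)$ and $q(n,k)$ by $$x(x+2)(x+4)\cdots(x+2n-2)=\sum_{k=1}^np(n,k)x^k,\qquad (x+1)(x+3)\cdots(x+2n-1)=\sum_{k=0}^nq(n,k)x^k.$$ Then for all $n\ge1$, $$D^n(a)=ab^n\sum_{k=1}^np(n,k)b^kc^{n-k}\quad\text{and}\quad D^n(ab)=ab^{n+1}\sum_{k=0}^nq(n,k)b^kc^{n-k}.$$
   Context: $D$ is the formal derivative of the context-free grammar $\{a\rightarrow ab^2, b\rightarrow b^2c, c\rightarrow bc^2\}$, i.e. a linear map satisfying the Leibniz rule $D(uv)=D(u)v+uD(v)$. *)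

theory Defs
  imports
    "HOL-Library.Poly_Mapping"
    "HOL-Computational_Algebra.Polynomial"
begin

datatype indet = A | B | C

text \<open>
  The polynomial ring \<open>\<rat>[a,b,c]\<close>: a monomial is a finitely supported exponent vector, a polynomial
  is a finitely supported family of rational coefficients indexed by monomials, with the
  convolution product of \<^theory>\<open>HOL-Library.Poly_Mapping\<close>.
\<close>

type_synonym qpoly = "(indet \<Rightarrow>\<^sub>0 nat) \<Rightarrow>\<^sub>0 rat"

definition indeterminate :: "indet \<Rightarrow> qpoly" where
  "indeterminate v = Poly_Mapping.single (Poly_Mapping.single v 1) 1"

abbreviation a :: qpoly where "a \<equiv> indeterminate A"
abbreviation b :: qpoly where "b \<equiv> indeterminate B"
abbreviation c :: qpoly where "c \<equiv> indeterminate C"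

definition const :: "rat \<Rightarrow> qpoly" where
  "const r = Poly_Mapping.single 0 r"

definition is_derivation :: "(qpoly \<Rightarrow> qpoly) \<Rightarrow> bool" where
  "is_derivation D \<longleftrightarrow>
     (\<forall>u v. D (u + v) = D u + D v) \<and>
     (\<forall>r u. D (const r * u) = const r * D u) \<and>
     (\<forall>u v. D (u * v) = D u * v + u * D v)"

definition p :: "nat \<Rightarrow> nat \<Rightarrow> int" where
  "p n k = coeff (\<Prod>i<n. [:2 * int i, 1:]) k"

definition q :: "nat \<Rightarrow> nat \<Rightarrow> int" where
  "q n k = coeff (\<Prod>i<n. [:2 * int i + 1, 1:]) k"

text \<open>The coefficients satisfy the expansions over the index ranges \<open>1..n\<close> and \<open>0..n\<close>.\<close>

lemma degree_prod_linear: "degree (\<Prod>i<n. [:f i, 1::int:]) = n"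
  by (subst degree_prod_eq_sum_degree) auto

lemma poly_q_expansion:
  "(\<Prod>i<n. x + (2 * int i + 1)) = (\<Sum>k=0..n. q n k * x ^ k)"
proof -
  have "(\<Prod>i<n. x + (2 * int i + 1)) = poly (\<Prod>i<n. [:2 * int i + 1, 1:]) x"
    by (simp add: poly_prod algebra_simps)
  also have "\<dots> = (\<Sum>k=0..n. q n k * x ^ k)"
    by (simp add: poly_altdef degree_prod_linear q_def atMost_atLeast0)
  finally show ?thesis .
qed

lemma poly_p_expansion:
  assumes "n \<ge> 1"
  shows "(\<Prod>i<n. x + 2 * int i) = (\<Sum>k=1..n. p n k * x ^ k)"
proof -
  have "p n 0 = poly (\<Prod>i<n. [:2 * int i, 1:]) 0"
    by (simp add: p_def poly_0_coeff_0)
  also have "\<dots> = 0"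
    using assms by (auto simp: poly_prod intro!: bexI[of _ 0])
  finally have p0: "p n 0 = 0" .
  have "(\<Prod>i<n. x + 2 * int i) = poly (\<Prod>i<n. [:2 * int i, 1:]) x"
    by (simp add: poly_prod algebra_simps)
  also have "\<dots> = (\<Sum>k=0..n. p n k * x ^ k)"
    by (simp add: poly_altdef degree_prod_linear p_def atMost_atLeast0)
  also have "\<dots> = (\<Sum>k=1..n. p n k * x ^ k)"
    by (simp add: sum.atLeast_Suc_atMost p0)
  finally show ?thesis .
qed

text \<open>
  A derivation of \<open>\<rat>[a,b,c]\<close> with prescribed values on the indeterminates exists and is unique.
\<close>

definition mono_deriv :: "(indet \<Rightarrow> qpoly) \<Rightarrow> (indet \<Rightarrow>\<^sub>0 nat) \<Rightarrow> rat \<Rightarrow> qpoly" where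
  "mono_deriv g m x =
     (\<Sum>v\<in>{A, B, C}. Poly_Mapping.single (m - Poly_Mapping.single v 1)
        (x * of_nat (Poly_Mapping.lookup m v)) * g v)"

definition deriv_ext :: "(indet \<Rightarrow> qpoly) \<Rightarrow> qpoly \<Rightarrow> qpoly" where
  "deriv_ext g f = (\<Sum>m\<in>Poly_Mapping.keys f. mono_deriv g m (Poly_Mapping.lookup f m))"

lemma mono_deriv_add: "mono_deriv g m (x + y) = mono_deriv g m x + mono_deriv g m y"
  by (simp add: mono_deriv_def single_add algebra_simps)

lemma mono_deriv_0: "mono_deriv g m 0 = 0"
  by (simp add: mono_deriv_def)

lemma deriv_ext_add: "deriv_ext g (u + v) = deriv_ext g u + deriv_ext g v"
  unfolding deriv_ext_def
  by (rule setsum_keys_plus_distrib) (simp_all add: mono_deriv_0 mono_deriv_add)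

lemma deriv_ext_single: "deriv_ext g (Poly_Mapping.single m x) = mono_deriv g m x"
  by (cases "x = 0") (simp_all add: deriv_ext_def mono_deriv_0)

lemma mono_deriv_summand:
  "Poly_Mapping.single (m + m' - Poly_Mapping.single v 1)
      (x * y * of_nat (Poly_Mapping.lookup (m + m') v)) =
   Poly_Mapping.single (m - Poly_Mapping.single v 1) (x * of_nat (Poly_Mapping.lookup m v))
     * Poly_Mapping.single m' y
   + Poly_Mapping.single m x
     * (Poly_Mapping.single (m' - Poly_Mapping.single v 1) (y * of_nat (Poly_Mapping.lookup m' v))
         :: qpoly)"
proof -
  have shift: "k - Poly_Mapping.single v 1 + k' = k + k' - Poly_Mapping.single v 1"
    if "Poly_Mapping.lookup k v \<noteq> 0" for k k' :: "indet \<Rightarrow>\<^sub>0 nat"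
    using that
    by (intro poly_mapping_eqI) (auto simp: lookup_add lookup_minus lookup_single when_def)
  have 1: "Poly_Mapping.single (m - Poly_Mapping.single v 1) (x * of_nat (Poly_Mapping.lookup m v))
     * Poly_Mapping.single m' y
     = (Poly_Mapping.single (m + m' - Poly_Mapping.single v 1)
         (x * y * of_nat (Poly_Mapping.lookup m v)) :: qpoly)"
    using shift[of m m']
    by (cases "Poly_Mapping.lookup m v = 0")
      (simp_all add: mult_single mult.assoc mult.commute[of y] mult.left_commute)
  have 2: "Poly_Mapping.single m x
     * Poly_Mapping.single (m' - Poly_Mapping.single v 1) (y * of_nat (Poly_Mapping.lookup m' v))
     = (Poly_Mapping.single (m + m' - Poly_Mapping.single v 1)
         (x * y * of_nat (Poly_Mapping.lookup m' v)) :: qpoly)"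
    using shift[of m' m]
    by (cases "Poly_Mapping.lookup m' v = 0") (simp_all add: mult_single mult_ac add_ac)
  show ?thesis
    unfolding 1 2 by (simp add: lookup_add algebra_simps flip: single_add)
qed

lemma mono_deriv_mult:
  "mono_deriv g (m + m') (x * y) =
     mono_deriv g m x * Poly_Mapping.single m' y + Poly_Mapping.single m x * mono_deriv g m' y"
  unfolding mono_deriv_def sum_distrib_left sum_distrib_right mono_deriv_summand
    sum.distrib[symmetric]
  by (rule sum.cong) (simp_all add: algebra_simps)

lemma qpoly_induct [case_names zero single add]:
  fixes f :: qpoly
  assumes "P 0" and "\<And>m x. P (Poly_Mapping.single m x)"
    and "\<And>u v. P u \<Longrightarrow> P v \<Longrightarrow> P (u + v)"
  shows "P f"
proof (induction f rule: Poly_Mapping.update_induct)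
  case const
  show ?case by fact
next
  case (update f m x)
  have "Poly_Mapping.update m x f = Poly_Mapping.single m x + f"
    using update by (intro poly_mapping_eqI)
      (auto simp: lookup_update lookup_add lookup_single when_def in_keys_iff)
  with update assms show ?case by simp
qed

lemma deriv_ext_mult: "deriv_ext g (u * v) = deriv_ext g u * v + u * deriv_ext g v"
proof (induction u rule: qpoly_induct)
  case zero
  show ?case by (simp add: deriv_ext_def)
next
  case (single m x)
  show ?case
  proof (induction v rule: qpoly_induct)
    case zero
    show ?case by (simp add: deriv_ext_def)
  next
    case (single m' y)
    show ?case by (simp add: mult_single deriv_ext_single mono_deriv_mult)
  next
    case (add u v)
    then show ?case by (simp add: deriv_ext_add algebra_simps)
  qed
next
  case (add u v)
  then show ?case by (simp add: deriv_ext_add algebra_simps)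
qed

lemma is_derivation_deriv_ext: "is_derivation (deriv_ext g)"
proof -
  have "deriv_ext g (const r) = 0" for r
    by (simp add: const_def deriv_ext_single mono_deriv_def)
  then show ?thesis
    by (simp add: is_derivation_def deriv_ext_add deriv_ext_mult)
qed

lemma deriv_ext_indeterminate: "deriv_ext g (indeterminate v) = g v"
  by (cases v) (simp_all add: indeterminate_def deriv_ext_single mono_deriv_def lookup_single)

lemma single_eq_indeterminates:
  "Poly_Mapping.single m x =
     const x * a ^ Poly_Mapping.lookup m A * b ^ Poly_Mapping.lookup m B
       * c ^ Poly_Mapping.lookup m C"
proof -
  have pow: "indeterminate v ^ n = Poly_Mapping.single (Poly_Mapping.single v n) 1" for v n
    by (induction n) (simp_all add: indeterminate_def mult_single flip: single_add)
  have "m = Poly_Mapping.single A (Poly_Mapping.lookup m A)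
      + Poly_Mapping.single B (Poly_Mapping.lookup m B)
      + Poly_Mapping.single C (Poly_Mapping.lookup m C)"
  proof (rule poly_mapping_eqI)
    fix v
    show "Poly_Mapping.lookup m v = Poly_Mapping.lookup
        (Poly_Mapping.single A (Poly_Mapping.lookup m A)
         + Poly_Mapping.single B (Poly_Mapping.lookup m B)
         + Poly_Mapping.single C (Poly_Mapping.lookup m C)) v"
      by (cases v) (simp_all add: lookup_add lookup_single)
  qed
  then show ?thesis
    by (simp add: pow const_def mult_single)
qed

lemma derivation_unique:
  assumes D: "is_derivation D" and E: "is_derivation E"
    and eq: "\<And>v. D (indeterminate v) = E (indeterminate v)"
  shows "D = E"
proof
  fix f
  have one: "F 1 = 0" if "is_derivation F" for F
  proof -
    have "F (1 * 1) = F 1 * 1 + 1 * F 1" using that unfolding is_derivation_def by blast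
    then show ?thesis by simp
  qed
  have pow: "D (indeterminate v ^ n) = E (indeterminate v ^ n)" for v n
  proof (induction n)
    case 0
    show ?case by (simp add: one D E)
  next
    case (Suc n)
    then show ?case using D E by (simp add: is_derivation_def eq)
  qed
  have "D (Poly_Mapping.single m x) = E (Poly_Mapping.single m x)" for m x
  proof -
    have const: "F (const x) = 0" if "is_derivation F" for F
    proof -
      have "F (const x * 1) = const x * F 1" using that unfolding is_derivation_def by blast
      then show ?thesis by (simp add: one that)
    qed
    from const[OF D] const[OF E] show ?thesis
      using D E unfolding single_eq_indeterminates by (simp add: is_derivation_def pow)
  qed
  then show "D f = E f"
  proof (induction f rule: qpoly_induct)
    case zero
    from zero[of 0 0] show ?case by simp
  next
    case (add u v)
    then show ?case using D E by (simp add: is_derivation_def)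
  qed
qed

lemma ex1_grammar_derivation:
  "\<exists>!D. is_derivation D \<and> D a = a * b ^ 2 \<and> D b = b ^ 2 * c \<and> D c = b * c ^ 2"
proof (rule ex1I)
  let ?g = "\<lambda>v. case v of A \<Rightarrow> a * b ^ 2 | B \<Rightarrow> b ^ 2 * c | C \<Rightarrow> b * c ^ 2"
  show "is_derivation (deriv_ext ?g) \<and> deriv_ext ?g a = a * b ^ 2 \<and>
      deriv_ext ?g b = b ^ 2 * c \<and> deriv_ext ?g c = b * c ^ 2"
    by (simp add: is_derivation_deriv_ext deriv_ext_indeterminate)
  fix D
  assume "is_derivation D \<and> D a = a * b ^ 2 \<and> D b = b ^ 2 * c \<and> D c = b * c ^ 2"
  then show "D = deriv_ext ?g"
    by (intro derivation_unique is_derivation_deriv_ext)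
      (auto simp: deriv_ext_indeterminate split: indet.split)
qed

end

theory Submission
  imports Defs
begin

text \<open>
  Since \<open>D (b + r c) = b c (b + r c)\<close> for every integer \<open>r\<close>, a product of \<open>n\<close> such factors is an
  eigenvector up to the factor \<open>n b c\<close>. Hence, by induction,
  \<open>D\<^sup>n (a b\<^sup>e) = a b\<^bsup>n+e\<^esup> \<Prod>i<n. (b + (2 i + e) c)\<close>, and the two cases \<open>e = 0, 1\<close> are the
  homogenizations of the products defining \<open>p\<close> and \<open>q\<close>.
\<close>

text \<open>Induction on \<open>n\<close>: the factor with constant term \<open>f n\<close> turns
  the coefficients into \<open>f n\<close> times the old ones plus the old ones shifted by one.
  After homogenization these two parts are \<open>y\<close> and \<open>x\<close> times the old
  sum.\<close>

lemma homogenize_prod_linear: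
  fixes x y :: "'a :: comm_ring_1" and f :: "nat \<Rightarrow> int"
  shows "(\<Prod>i<n. x + of_int (f i) * y) =
    (\<Sum>k\<le>n. of_int (coeff (\<Prod>i<n. [:f i, 1:]) k) * x ^ k * y ^ (n - k))"
proof (induction n)
  case 0
  show ?case by simp
next
  case (Suc n)
  define P where "P = (\<Prod>i<n. [:f i, 1:])"
  define S where "S = (\<Sum>k\<le>n. of_int (coeff P k) * x ^ k * y ^ (n - k))"
  have P_Suc: "(\<Prod>i<Suc n. [:f i, 1:]) = smult (f n) P + pCons 0 P"
    by (simp add: P_def algebra_simps)
  \<comment> \<open>The term \<open>k = Suc n\<close> has exponent 0 on \<open>y\<close>, so it must
    vanish before \<open>y\<close> can be factored out.\<close>
  have "coeff P (Suc n) = 0"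
    by (rule coeff_eq_0) (simp add: P_def degree_prod_linear)
  then have "(\<Sum>k\<le>Suc n. of_int (coeff P k) * x ^ k * y ^ (Suc n - k)) = y * S"
    unfolding S_def sum_distrib_left
    by (auto intro!: sum.cong simp: Suc_diff_le mult_ac)
  moreover have "(\<Sum>k\<le>Suc n. of_int (coeff (pCons 0 P) k) * x ^ k * y ^ (Suc n - k)) = x * S"
    unfolding S_def sum_distrib_left
    by (subst sum.atMost_Suc_shift) (auto intro!: sum.cong simp: mult_ac)
  ultimately have "(\<Sum>k\<le>Suc n. of_int (coeff (smult (f n) P + pCons 0 P) k)
      * x ^ k * y ^ (Suc n - k)) = of_int (f n) * (y * S) + x * S"
    by (simp only: coeff_add coeff_smult of_int_add of_int_mult distrib_right sum.distrib
        mult.assoc sum_distrib_left[symmetric])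
  also have "\<dots> = (\<Prod>i<Suc n. x + of_int (f i) * y)"
    using Suc by (simp add: S_def P_def algebra_simps)
  finally show ?case unfolding P_Suc by (rule sym)
qed

text \<open>For \<open>n \<ge> 1\<close> the product contains the factor with \<open>i = 0\<close>,
  which vanishes at 0.\<close>

lemma p_0: "n \<ge> 1 \<Longrightarrow> p n 0 = 0"
  by (auto simp: p_def poly_prod simp flip: poly_0_coeff_0 intro!: bexI[of _ 0])

context
  fixes D :: "qpoly \<Rightarrow> qpoly"
  assumes D: "is_derivation D"
begin

lemma derivation_add: "D (u + v) = D u + D v"
  and derivation_mult: "D (u * v) = D u * v + u * D v"
  using D by (simp_all add: is_derivation_def)

lemma derivation_1: "D 1 = 0"
  using derivation_mult[of 1 1] by simp

lemma derivation_of_int: "D (of_int r) = 0"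
proof -
  interpret additive D
    by standard (rule derivation_add)
  have "D (of_nat k) = 0" for k
    by (induction k) (simp_all add: zero add derivation_1)
  then show ?thesis
    by (cases r rule: int_cases2) (simp_all add: minus)
qed

text \<open>By the Leibniz rule, eigenvalues add when eigenvectors are multiplied; here the
  eigenvalue \<open>w\<close> is itself a polynomial.\<close>

lemma derivation_power_eigen:
  assumes "D u = w * u"
  shows "D (u ^ n) = of_nat n * w * u ^ n"
  by (induction n) (simp_all add: assms derivation_1 derivation_mult algebra_simps)

lemma derivation_prod_eigen:
  fixes n :: nat
  assumes "\<And>i. D (f i) = w * f i"
  shows "D (\<Prod>i<n. f i) = of_nat n * w * (\<Prod>i<n. f i)"
  by (induction n) (simp_all add: assms derivation_1 derivation_mult algebra_simps)

lemma funpow_grammar_derivation: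
  assumes Da: "D a = a * b ^ 2" and Db: "D b = b ^ 2 * c" and Dc: "D c = b * c ^ 2"
  shows "(D ^^ n) (a * b ^ e) =
    a * b ^ (n + e) * (\<Prod>i<n. b + of_int (2 * int i + int e) * c)"
proof (induction n)
  case 0
  show ?case by simp
next
  case (Suc n)
  define f where "f i = b + of_int (2 * int i + int e) * c" for i
  have "D (f i) = (b * c) * f i" for i
    by (simp only: f_def derivation_add derivation_mult derivation_of_int Db Dc)
      (simp add: algebra_simps power2_eq_square)
  note 1 = derivation_prod_eigen[of f, OF this]
  have "D b = (b * c) * b"
    by (simp add: Db power2_eq_square mult_ac)
  note 2 = derivation_power_eigen[OF this]
  have "(D ^^ Suc n) (a * b ^ e) = D (a * b ^ (n + e) * (\<Prod>i<n. f i))"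
    using Suc by (simp add: f_def)
  \<comment> \<open>The three factors contribute \<open>b^2\<close>, \<open>(n + e) b c\<close> and
    \<open>n b c\<close>. Their sum is \<open>b (b + (2 n + e) c) = b * f n\<close>, which supplies
    both the extra \<open>b\<close> and the next factor.\<close>
  also have "\<dots> = a * b ^ (Suc n + e) * ((\<Prod>i<n. f i) * f n)"
    by (simp only: derivation_mult Da 1 2)
      (simp add: f_def algebra_simps power2_eq_square)
  finally show ?case by (simp add: f_def)
qed

end

theorem theorem4:
  fixes D :: "qpoly \<Rightarrow> qpoly" and n :: nat
  assumes "is_derivation D"
    and "D a = a * b ^ 2" and "D b = b ^ 2 * c" and "D c = b * c ^ 2"
    and "n \<ge> 1"
  shows "(D ^^ n) a = a * b ^ n * (\<Sum>k=1..n. of_int (p n k) * b ^ k * c ^ (n - k)) \<and>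
         (D ^^ n) (a * b) = a * b ^ (n + 1) * (\<Sum>k=0..n. of_int (q n k) * b ^ k * c ^ (n - k))"
proof
  \<comment> \<open>The product is expanded with \<open>x = b\<close>, \<open>y = c\<close> and
    \<open>f i = 2 i + e\<close>.\<close>
  note D_pow = funpow_grammar_derivation[OF assms(1-4), unfolded homogenize_prod_linear]
  have "(D ^^ n) a = a * b ^ n * (\<Sum>k\<le>n. of_int (p n k) * b ^ k * c ^ (n - k))"
    using D_pow[of n 0] by (simp add: p_def)
  also have "(\<Sum>k\<le>n. of_int (p n k) * b ^ k * c ^ (n - k)) =
      (\<Sum>k=1..n. of_int (p n k) * b ^ k * c ^ (n - k))"
    by (simp add: atMost_atLeast0 sum.atLeast_Suc_atMost p_0[OF assms(5)])
  finally show "(D ^^ n) a =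
      a * b ^ n * (\<Sum>k=1..n. of_int (p n k) * b ^ k * c ^ (n - k))" .
  show "(D ^^ n) (a * b) =
      a * b ^ (n + 1) * (\<Sum>k=0..n. of_int (q n k) * b ^ k * c ^ (n - k))"
    using D_pow[of n 1] by (simp add: q_def atMost_atLeast0)
qed

end
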